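(* Let $E$ be a normed space, let $f\colon E\to E$, and let $p,q\in[1,+\infty)$. Assume that the composition operator $C_f$ maps $l^p(E)$ into $bv_q(E)$. Then $C_f\colon l^p(E)\to bv_q(E)$ is continuous if and only if $f$ is continuous.
   Context: $E$ is a normed space over $\mathbb R$ or $\mathbb C$ with norm $\|\cdot\|$. For a map $f\colon E\to E$, the composition operator $C_f$ assigns to a sequence $x\colon\mathbb N\to E$ the sequence $C_f(x)$ with $C_f(x)(n)=f(x(n))$ for all $n\in\mathbb N$. $l^p(E)$ is the space of sequences $x\colon\mathbb N\to E$ with $\|x\|_{l^p}=\bigl(\sum_{n=1}^\infty\|x(n)\|^p\bigr)^{1/p}<+\infty$. $bv_q(E)$ is the space of all sequences $x\colon\mathbb N\to E$ with $\sum_{n=1}^\infty\|x(n+1)-x(n)\|^q<+\infty$, with norm $\|x\|_{bv_q}=\|x(1)\|+\bigl(\sum_{n=1}^\infty\|x(n+1)-x(n)\|^q\bigr)^{1/q}$. *)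

theory Defs
  imports "HOL-Analysis.Analysis"
begin

text \<open>
  Sequences in \<open>E\<close> are functions of type \<open>nat \<Rightarrow> 'a\<close> with \<open>'a :: real_normed_vector\<close>; a complex
  normed space is covered through its underlying real one. Indices start at \<open>0\<close>, so \<open>x n\<close> here is
  the term traditionally written \<open>x(n+1)\<close>.

  Since \<open>suminf\<close> has no meaningful value on divergent series, finiteness is expressed by
  \<open>summable\<close>, and the norms below are intended only for members of the respective spaces.
\<close>

definition comp_op :: "('a \<Rightarrow> 'a) \<Rightarrow> (nat \<Rightarrow> 'a) \<Rightarrow> nat \<Rightarrow> 'a" where
  "comp_op f x = (\<lambda>n. f (x n))"

definition lp_space :: "real \<Rightarrow> (nat \<Rightarrow> 'a::real_normed_vector) set" where
  "lp_space p = {x. summable (\<lambda>n. norm (x n) powr p)}"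

definition lp_norm :: "real \<Rightarrow> (nat \<Rightarrow> 'a::real_normed_vector) \<Rightarrow> real" where
  "lp_norm p x = (\<Sum>n. norm (x n) powr p) powr (1 / p)"

definition bv_space :: "real \<Rightarrow> (nat \<Rightarrow> 'a::real_normed_vector) set" where
  "bv_space q = {x. summable (\<lambda>n. norm (x (Suc n) - x n) powr q)}"

definition bv_norm :: "real \<Rightarrow> (nat \<Rightarrow> 'a::real_normed_vector) \<Rightarrow> real" where
  "bv_norm q x = norm (x 0) + (\<Sum>n. norm (x (Suc n) - x n) powr q) powr (1 / q)"

definition lp_dist :: "real \<Rightarrow> (nat \<Rightarrow> 'a::real_normed_vector) \<Rightarrow> (nat \<Rightarrow> 'a) \<Rightarrow> real" where
  "lp_dist p x y = lp_norm p (\<lambda>n. x n - y n)"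

definition bv_dist :: "real \<Rightarrow> (nat \<Rightarrow> 'a::real_normed_vector) \<Rightarrow> (nat \<Rightarrow> 'a) \<Rightarrow> real" where
  "bv_dist q x y = bv_norm q (\<lambda>n. x n - y n)"

definition lp_topology :: "real \<Rightarrow> (nat \<Rightarrow> 'a::real_normed_vector) topology" where
  "lp_topology p = Metric_space.mtopology (lp_space p) (lp_dist p)"

definition bv_topology :: "real \<Rightarrow> (nat \<Rightarrow> 'a::real_normed_vector) topology" where
  "bv_topology q = Metric_space.mtopology (bv_space q) (bv_dist q)"

text \<open>
  The topologies are meaningful for exponents at least \<open>1\<close>: by Minkowski's inequality both
  distances are then metrics on the respective spaces.
\<close>

lemma powr_sum_le:
  fixes a b A B p :: real
  assumes p: "1 \<le> p" and ab: "0 \<le> a" "0 \<le> b" and AB: "0 < A" "0 < B"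
  shows "(a + b) powr p \<le>
    (A + B) powr p * (A / (A + B) * (a powr p / A powr p) + B / (A + B) * (b powr p / B powr p))"
proof -
  define s where "s = A / (A + B)"
  define t where "t = B / (A + B)"
  have st: "0 < s" "0 < t" "s + t = 1"
    using AB by (auto simp: s_def t_def add_divide_distrib[symmetric])
  have s1: "s \<le> 1" "t \<le> 1" using st by linarith+
  have scale: "c * u powr p \<ge> (c * u) powr p" if "0 < c" "c \<le> 1" "0 \<le> u" for c u :: real
  proof -
    have "c powr p \<le> c powr 1" using that p by (intro powr_mono') auto
    then show ?thesis using that by (simp add: powr_mult mult_right_mono)
  qed
  have key: "(s * u + t * v) powr p \<le> s * u powr p + t * v powr p" if uv: "0 \<le> u" "0 \<le> v" for u v
  proof -
    consider "u = 0" | "v = 0" | "0 < u" "0 < v"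
      using uv by linarith
    then show ?thesis
    proof cases
      case 1 then show ?thesis using scale[of t v] st s1 that by simp
    next
      case 2 then show ?thesis using scale[of s u] st s1 that by simp
    next
      case 3
      then show ?thesis
        using convex_onD[OF powr_convex[OF p], of t u v] st s1
        by (simp add: algebra_simps eq_diff_eq[of s 1 t, THEN iffD2])
    qed
  qed
  have "a + b = (A + B) * (s * (a / A) + t * (b / B))"
  proof -
    have "s * (a / A) = a / (A + B)" "t * (b / B) = b / (A + B)"
      using AB by (simp_all add: s_def t_def)
    then show ?thesis using AB by (simp add: add_divide_distrib[symmetric])
  qed
  then have "(a + b) powr p = (A + B) powr p * (s * (a / A) + t * (b / B)) powr p"
    using AB ab st by (simp add: powr_mult)
  also have "\<dots> \<le> (A + B) powr p * (s * (a / A) powr p + t * (b / B) powr p)"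
    using key[of "a / A" "b / B"] ab AB by (intro mult_left_mono) auto
  finally show ?thesis using ab AB by (simp add: s_def t_def powr_divide)
qed

lemma lp_norm_nonneg: "0 \<le> lp_norm p x"
  by (simp add: lp_norm_def)

lemma lp_suminf_le:
  assumes "1 \<le> p" "x \<in> lp_space p" "lp_norm p x \<le> A"
  shows "(\<Sum>n. norm (x n) powr p) \<le> A powr p"
proof -
  have "0 \<le> (\<Sum>n. norm (x n) powr p)"
    using assms by (intro suminf_nonneg) (auto simp: lp_space_def)
  then have "(\<Sum>n. norm (x n) powr p) = lp_norm p x powr p"
    using assms by (simp add: lp_norm_def powr_powr)
  also have "\<dots> \<le> A powr p"
    using assms lp_norm_nonneg by (intro powr_mono2) auto
  finally show ?thesis .
qed

lemma lp_minkowski: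
  assumes p: "1 \<le> p" and x: "x \<in> lp_space p" and y: "y \<in> lp_space p"
  shows "(\<lambda>n. x n + y n) \<in> lp_space p"
    and "lp_norm p (\<lambda>n. x n + y n) \<le> lp_norm p x + lp_norm p y"
proof -
  have sx: "summable (\<lambda>n. norm (x n) powr p)" and sy: "summable (\<lambda>n. norm (y n) powr p)"
    using x y by (auto simp: lp_space_def)
  have main: "summable (\<lambda>n. norm (x n + y n) powr p) \<and> lp_norm p (\<lambda>n. x n + y n) \<le> A + B"
    if A: "lp_norm p x < A" and B: "lp_norm p y < B" for A B
  proof -
    have AB: "0 < A" "0 < B"
      using A B lp_norm_nonneg[of p x] lp_norm_nonneg[of p y] by linarith+
    define g where "g n = (A + B) powr p *
      (A / (A + B) * (norm (x n) powr p / A powr p) + B / (A + B) * (norm (y n) powr p / B powr p))"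
      for n
    have le: "norm (x n + y n) powr p \<le> g n" for n
    proof -
      have "norm (x n + y n) powr p \<le> (norm (x n) + norm (y n)) powr p"
        using p by (intro powr_mono2 norm_triangle_ineq) auto
      also have "\<dots> \<le> g n"
        unfolding g_def by (rule powr_sum_le) (use p AB in auto)
      finally show ?thesis .
    qed
    have sg: "summable g"
      unfolding g_def by (intro summable_mult summable_add summable_divide sx sy)
    have s: "summable (\<lambda>n. norm (x n + y n) powr p)"
      by (rule summable_comparison_test'[OF sg, of 0]) (use le in auto)
    have "(\<Sum>n. norm (x n + y n) powr p) \<le> suminf g"
      by (rule suminf_le[OF le s sg])
    also have "suminf g = (A + B) powr p *
        (A / (A + B) * ((\<Sum>n. norm (x n) powr p) / A powr p) +
         B / (A + B) * ((\<Sum>n. norm (y n) powr p) / B powr p))"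
      unfolding g_def using sx sy
      by (simp add: suminf_mult suminf_add[symmetric] suminf_divide summable_add summable_mult
          summable_divide)
    also have "\<dots> \<le> (A + B) powr p * (A / (A + B) * 1 + B / (A + B) * 1)"
      using AB lp_suminf_le[OF p x less_imp_le[OF A]] lp_suminf_le[OF p y less_imp_le[OF B]]
      by (intro mult_left_mono add_mono) (auto simp: divide_le_eq)
    also have "\<dots> = (A + B) powr p"
      using AB by (simp add: add_divide_distrib[symmetric])
    finally have "(\<Sum>n. norm (x n + y n) powr p) \<le> (A + B) powr p" .
    then have "lp_norm p (\<lambda>n. x n + y n) \<le> ((A + B) powr p) powr (1 / p)"
      unfolding lp_norm_def using p s by (intro powr_mono2 suminf_nonneg) auto
    also have "\<dots> = A + B" using p AB by (simp add: powr_powr)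
    finally show ?thesis using s by simp
  qed
  show "(\<lambda>n. x n + y n) \<in> lp_space p"
    using main[of "lp_norm p x + 1" "lp_norm p y + 1"] by (simp add: lp_space_def)
  show "lp_norm p (\<lambda>n. x n + y n) \<le> lp_norm p x + lp_norm p y"
  proof (rule field_le_epsilon)
    fix e :: real assume "0 < e"
    then show "lp_norm p (\<lambda>n. x n + y n) \<le> lp_norm p x + lp_norm p y + e"
      using main[of "lp_norm p x + e / 2" "lp_norm p y + e / 2"] by auto
  qed
qed

lemma lp_norm_minus: "lp_norm p (\<lambda>n. x n - y n) = lp_norm p (\<lambda>n. y n - x n)"
  by (simp add: lp_norm_def norm_minus_commute)

lemma lp_space_diff:
  assumes "1 \<le> p" "x \<in> lp_space p" "y \<in> lp_space p"
  shows "(\<lambda>n. x n - y n) \<in> lp_space p"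
  using lp_minkowski(1)[OF assms(1,2), of "\<lambda>n. - y n"] assms(3) by (simp add: lp_space_def)

lemma lp_norm_eq_0_iff:
  assumes "1 \<le> p" "x \<in> lp_space p"
  shows "lp_norm p x = 0 \<longleftrightarrow> (\<forall>n. x n = 0)"
  using assms by (simp add: lp_norm_def lp_space_def suminf_eq_zero_iff)

lemma lp_norm_triangle_diff:
  assumes "1 \<le> p" "(\<lambda>n. x n - y n) \<in> lp_space p" "(\<lambda>n. y n - z n) \<in> lp_space p"
  shows "lp_norm p (\<lambda>n. x n - z n) \<le> lp_norm p (\<lambda>n. x n - y n) + lp_norm p (\<lambda>n. y n - z n)"
  using lp_minkowski(2)[OF assms] by simp

lemma Metric_space_lp:
  assumes "1 \<le> p"
  shows "Metric_space (lp_space p) (lp_dist p)"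
proof
  show "0 \<le> lp_dist p x y" for x y :: "nat \<Rightarrow> 'a"
    by (simp add: lp_dist_def lp_norm_nonneg)
  show "lp_dist p x y = lp_dist p y x" for x y :: "nat \<Rightarrow> 'a"
    unfolding lp_dist_def by (rule lp_norm_minus)
  show "lp_dist p x y = 0 \<longleftrightarrow> x = y" if "x \<in> lp_space p" "y \<in> lp_space p" for x y :: "nat \<Rightarrow> 'a"
    unfolding lp_dist_def lp_norm_eq_0_iff[OF assms lp_space_diff[OF assms that]]
    by (simp add: fun_eq_iff)
  show "lp_dist p x z \<le> lp_dist p x y + lp_dist p y z"
    if "x \<in> lp_space p" "y \<in> lp_space p" "z \<in> lp_space p" for x y z :: "nat \<Rightarrow> 'a"
    unfolding lp_dist_def using assms that by (intro lp_norm_triangle_diff lp_space_diff)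
qed

lemma bv_space_iff_lp: "x \<in> bv_space q \<longleftrightarrow> (\<lambda>n. x (Suc n) - x n) \<in> lp_space q"
  by (simp add: bv_space_def lp_space_def)

lemma bv_dist_eq_lp:
  "bv_dist q x y = norm (x 0 - y 0) +
     lp_norm q (\<lambda>n. (x (Suc n) - x n) - (y (Suc n) - y n))"
  by (simp add: bv_dist_def bv_norm_def lp_norm_def algebra_simps)

lemma Metric_space_bv:
  assumes "1 \<le> q"
  shows "Metric_space (bv_space q) (bv_dist q)"
proof
  show "0 \<le> bv_dist q x y" for x y :: "nat \<Rightarrow> 'a"
    by (simp add: bv_dist_eq_lp lp_norm_nonneg)
  show "bv_dist q x y = bv_dist q y x" for x y :: "nat \<Rightarrow> 'a"
    unfolding bv_dist_eq_lp by (intro arg_cong2[where f = "(+)"] norm_minus_commute lp_norm_minus)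
  show "bv_dist q x y = 0 \<longleftrightarrow> x = y" if "x \<in> bv_space q" "y \<in> bv_space q" for x y :: "nat \<Rightarrow> 'a"
  proof
    assume "bv_dist q x y = 0"
    then have 0: "x 0 = y 0" and *: "lp_norm q (\<lambda>n. (x (Suc n) - x n) - (y (Suc n) - y n)) = 0"
      using lp_norm_nonneg[of q "\<lambda>n. (x (Suc n) - x n) - (y (Suc n) - y n)"]
      by (auto simp: bv_dist_eq_lp add_nonneg_eq_0_iff)
    have step: "(x (Suc n) - x n) - (y (Suc n) - y n) = 0" for n
      using * that lp_norm_eq_0_iff[OF assms lp_space_diff[OF assms]]
      unfolding bv_space_iff_lp by blast
    have "x n = y n" for n
    proof (induction n)
      case (Suc n)
      then show ?case using step[of n] by simp
    qed (rule 0)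
    then show "x = y" by blast
  qed (simp add: bv_dist_def bv_norm_def)
  show "bv_dist q x z \<le> bv_dist q x y + bv_dist q y z"
    if "x \<in> bv_space q" "y \<in> bv_space q" "z \<in> bv_space q" for x y z :: "nat \<Rightarrow> 'a"
  proof -
    have "norm (x 0 - z 0) \<le> norm (x 0 - y 0) + norm (y 0 - z 0)"
      using norm_triangle_ineq[of "x 0 - y 0" "y 0 - z 0"] by simp
    moreover have "lp_norm q (\<lambda>n. (x (Suc n) - x n) - (z (Suc n) - z n)) \<le>
        lp_norm q (\<lambda>n. (x (Suc n) - x n) - (y (Suc n) - y n)) +
        lp_norm q (\<lambda>n. (y (Suc n) - y n) - (z (Suc n) - z n))"
      using that unfolding bv_space_iff_lp
      by (intro lp_norm_triangle_diff assms) (rule lp_space_diff[OF assms]; assumption)+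
    ultimately show ?thesis by (simp add: bv_dist_eq_lp)
  qed
qed

end

theory Submission
  imports Defs
begin

text \<open>
  If \<open>C\<^sub>f\<close> maps \<open>l\<^sup>p\<close> into \<open>bv\<^sub>q\<close>, then \<open>\<parallel>f u - f 0\<parallel>\<^sup>q \<le> L \<parallel>u\<parallel>\<^sup>p\<close> for all small \<open>u\<close>: otherwise a
  sequence \<open>0, u\<^sub>0, 0, u\<^sub>1, \<dots>\<close> in which suitable bad points are repeated suitably often lies in \<open>l\<^sup>p\<close>
  while its image has infinite \<open>q\<close>-variation. For \<open>y\<close> close to \<open>x\<close> in \<open>l\<^sup>p\<close>, this estimate makes the
  tail of \<open>\<Sum>n. \<parallel>f (x n) - f (y n)\<parallel>\<^sup>q\<close> uniformly small, and continuity of \<open>f\<close> takes care of the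
  remaining finitely many terms. Conversely, \<open>f\<close> is recovered from \<open>C\<^sub>f\<close> on the sequences
  \<open>u, 0, 0, \<dots>\<close>.
\<close>

section \<open>Elementary power inequalities\<close>

lemma powr_add_le:
  fixes a b p :: real
  assumes "0 \<le> p" "0 \<le> a" "0 \<le> b"
  shows "(a + b) powr p \<le> 2 powr p * (a powr p + b powr p)"
proof -
  have "(a + b) powr p \<le> (2 * max a b) powr p"
    using assms by (intro powr_mono2) auto
  also have "\<dots> = 2 powr p * max a b powr p"
    using assms by (simp add: powr_mult)
  also have "\<dots> \<le> 2 powr p * (a powr p + b powr p)"
    by (intro mult_left_mono) (auto simp: max_def)
  finally show ?thesis .
qed

lemma norm_add_powr_le:
  fixes a b :: "'a::real_normed_vector"
  assumes "0 \<le> p"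
  shows "norm (a + b) powr p \<le> 2 powr p * (norm a powr p + norm b powr p)"
proof -
  have "norm (a + b) powr p \<le> (norm a + norm b) powr p"
    using assms by (intro powr_mono2 norm_triangle_ineq) auto
  also have "\<dots> \<le> 2 powr p * (norm a powr p + norm b powr p)"
    using assms by (intro powr_add_le) auto
  finally show ?thesis .
qed

lemma norm_diff_powr_le:
  fixes a b :: "'a::real_normed_vector"
  assumes "0 \<le> p"
  shows "norm (a - b) powr p \<le> 2 powr p * (norm a powr p + norm b powr p)"
  using norm_add_powr_le[OF assms, of a "- b"] by simp

section \<open>A local growth bound for \<open>f\<close> at \<open>0\<close>\<close>

lemma has_sum_indicator_lessThan:
  fixes a :: real
  shows "((\<lambda>j. if j < m then a else 0) has_sum real m * a) (UNIV :: nat set)"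
proof -
  have "((\<lambda>j. a) has_sum real m * a) {..<m}"
    using has_sum_finite[of "{..<m}" "\<lambda>j. a"] by simp
  then show ?thesis
    by (rule has_sum_cong_neutral[THEN iffD1, rotated -1]) auto
qed

text \<open>A gliding-hump argument. If no pair \<open>\<delta>\<close>, \<open>L\<close> works,
  then \<open>(1/2) ^ k\<close>, \<open>2 ^ k\<close> fails at some \<open>u k\<close>. Repeating
  \<open>u k\<close> about \<open>(1/2) ^ k / \<phi> (u k)\<close> times costs at most
  \<open>2 * (1/2) ^ k\<close> in the \<open>\<phi>\<close>-sum, yet adds at least \<open>1\<close>
  to the \<open>\<psi>\<close>-sum. Here \<open>\<phi>\<close> stands for
  \<open>norm u powr p\<close>, \<open>\<psi>\<close> for \<open>norm (f u - f 0) powr q\<close> and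
  \<open>o'\<close> for \<open>0\<close>.\<close>

lemma local_bound_of_summable_comp:
  fixes \<phi> \<psi> :: "'b \<Rightarrow> real"
  assumes nonneg: "\<And>u. 0 \<le> \<phi> u" "\<And>u. 0 \<le> \<psi> u"
    and zero: "\<phi> o' = 0" "\<psi> o' = 0"
    and comp: "\<And>z :: nat \<Rightarrow> 'b. summable (\<lambda>n. \<phi> (z n)) \<Longrightarrow> summable (\<lambda>n. \<psi> (z n))"
  obtains \<delta> L where "0 < \<delta>" "0 < L" "\<And>u. \<phi> u \<le> \<delta> \<Longrightarrow> \<psi> u \<le> L * \<phi> u"
proof (rule ccontr)
  assume "\<not> thesis"
  have "\<exists>u. \<phi> u \<le> (1/2) ^ k \<and> 2 ^ k * \<phi> u < \<psi> u" for k :: nat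
  proof (rule ccontr)
    assume "\<not> ?thesis"
    then have "\<phi> u \<le> (1/2) ^ k \<Longrightarrow> \<psi> u \<le> 2 ^ k * \<phi> u" for u
      by (auto simp: not_less)
    then show False
      using that[of "(1/2) ^ k" "2 ^ k"] \<open>\<not> thesis\<close> by auto
  qed
  then obtain u where u: "\<And>k. \<phi> (u k) \<le> (1/2) ^ k" "\<And>k. 2 ^ k * \<phi> (u k) < \<psi> (u k)"
    by metis
  \<comment> \<open>If \<open>\<phi>\<close> vanished at \<open>u k\<close>, the constant sequence
    \<open>u k\<close> would have summable \<open>\<phi>\<close>-values, which forces
    \<open>\<psi> (u k) = 0\<close> against the strict inequality for \<open>u k\<close>. Hence
    division by \<open>\<phi> (u k)\<close> is meaningful.\<close>
  have pos: "0 < \<phi> (u k)" for k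
  proof (rule ccontr)
    assume "\<not> 0 < \<phi> (u k)"
    then have "\<phi> (u k) = 0" using nonneg(1)[of "u k"] by simp
    moreover from this have "summable (\<lambda>n::nat. \<psi> (u k))"
      by (intro comp) simp
    ultimately show False using u(2)[of k] by (simp add: summable_const_iff)
  qed
  define m where "m k = nat \<lceil>(1/2) ^ k / \<phi> (u k)\<rceil>" for k
  have m_lower: "(1/2) ^ k / \<phi> (u k) \<le> real (m k)" for k
    unfolding m_def by (rule real_nat_ceiling_ge)
  have m_upper: "real (m k) \<le> (1/2) ^ k / \<phi> (u k) + 1" for k
    unfolding m_def using pos[of k] of_int_ceiling_le_add_one[of "(1/2) ^ k / \<phi> (u k)"]
    by (simp add: less_imp_le)
  \<comment> \<open>Row \<open>k\<close> holds \<open>m k\<close> copies of \<open>u k\<close>,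
    padded by the neutral point \<open>o'\<close>. Since all terms are nonnegative, the array can be
    summed by rows and also listed as one sequence by \<open>prod_decode\<close>, with no
    bookkeeping of block boundaries.\<close>
  define z where "z = (\<lambda>(k, j). if j < m k then u k else o')"
  have \<phi>_sum: "((\<lambda>j. \<phi> (z (k, j))) has_sum real (m k) * \<phi> (u k)) UNIV" for k
  proof -
    have "(\<lambda>j. \<phi> (z (k, j))) = (\<lambda>j. if j < m k then \<phi> (u k) else 0)"
      by (auto simp: z_def zero fun_eq_iff)
    then show ?thesis using has_sum_indicator_lessThan by simp
  qed
  have \<psi>_sum: "((\<lambda>j. \<psi> (z (k, j))) has_sum real (m k) * \<psi> (u k)) UNIV" for k
  proof -
    have "(\<lambda>j. \<psi> (z (k, j))) = (\<lambda>j. if j < m k then \<psi> (u k) else 0)"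
      by (auto simp: z_def zero fun_eq_iff)
    then show ?thesis using has_sum_indicator_lessThan by simp
  qed
  \<comment> \<open>Rounding up adds less than one extra copy, which costs at most
    \<open>\<phi> (u k) \<le> (1/2) ^ k\<close>; hence the factor \<open>2\<close>.\<close>
  have \<phi>_le: "real (m k) * \<phi> (u k) \<le> 2 * (1/2) ^ k" for k
  proof -
    have "real (m k) * \<phi> (u k) \<le> ((1/2) ^ k / \<phi> (u k) + 1) * \<phi> (u k)"
      using m_upper[of k] pos[of k] by (intro mult_right_mono) auto
    also have "\<dots> = (1/2) ^ k + \<phi> (u k)"
      using pos[of k] by (simp add: field_simps)
    finally show ?thesis using u(1)[of k] by simp
  qed
  have \<psi>_ge: "1 \<le> real (m k) * \<psi> (u k)" for k
  proof -
    have "1 = (1/2) ^ k / \<phi> (u k) * (2 ^ k * \<phi> (u k))"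
      using pos[of k] by (simp add: power_divide)
    also have "\<dots> \<le> real (m k) * \<psi> (u k)"
      using m_lower[of k] u(2)[of k] pos[of k] by (intro mult_mono) auto
    finally show ?thesis .
  qed
  have "summable (\<lambda>k. real (m k) * \<phi> (u k))"
    by (rule summable_comparison_test'
        [OF summable_mult[OF summable_geometric[of "1/2::real"]], of 0 _ 2])
      (use \<phi>_le nonneg in auto)
  then have "(\<lambda>k. real (m k) * \<phi> (u k)) summable_on UNIV"
    by (subst summable_on_UNIV_nonneg_real_iff) (use nonneg in auto)
  then have "(\<lambda>i. \<phi> (z i)) summable_on UNIV \<times> UNIV"
    by (intro summable_on_SigmaI[where g = "\<lambda>k. real (m k) * \<phi> (u k)"] \<phi>_sum nonneg)
  then have "(\<lambda>n. \<phi> (z (prod_decode n))) summable_on UNIV"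
    using summable_on_reindex_bij_betw[OF bij_prod_decode, of "\<lambda>i. \<phi> (z i)"] by simp
  then have "summable (\<lambda>n. \<psi> (z (prod_decode n)))"
    using comp[of "\<lambda>n. z (prod_decode n)"] nonneg by (simp add: summable_on_UNIV_nonneg_real_iff)
  then have "(\<lambda>n. \<psi> (z (prod_decode n))) summable_on UNIV"
    using nonneg by (simp add: summable_on_UNIV_nonneg_real_iff)
  then have "(\<lambda>i. \<psi> (z i)) summable_on UNIV \<times> UNIV"
    using summable_on_reindex_bij_betw[OF bij_prod_decode, of "\<lambda>i. \<psi> (z i)"] by simp
  then have "(\<lambda>k. infsum (\<lambda>j. \<psi> (z (k, j))) UNIV) summable_on UNIV"
    by (rule summable_on_SigmaD) (use \<psi>_sum in \<open>auto simp: summable_on_def\<close>)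
  then have "(\<lambda>k. real (m k) * \<psi> (u k)) summable_on UNIV"
    using infsumI[OF \<psi>_sum] by simp
  then have "summable (\<lambda>k. real (m k) * \<psi> (u k))"
    by (rule summable_on_imp_summable)
  \<comment> \<open>The row sums of \<open>\<psi>\<close> would have to tend to \<open>0\<close>,
    although each is at least \<open>1\<close>.\<close>
  then have "(\<lambda>k. real (m k) * \<psi> (u k)) \<longlonglongrightarrow> 0"
    by (rule summable_LIMSEQ_zero)
  then show False
    using LIMSEQ_le_const[of _ 0 1] \<psi>_ge by force
qed

text \<open>Interleaving \<open>z\<close> with zeros keeps it in the \<open>p\<close>-summable
  sequences, and every second increment of the image is exactly \<open>f (z n) - f 0\<close>. This
  turns information about variation into information about values.\<close>

lemma summable_comp_diff_zero:
  fixes f :: "'a::real_normed_vector \<Rightarrow> 'a"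
  assumes p: "1 \<le> p" and maps: "\<forall>x \<in> lp_space p. comp_op f x \<in> bv_space q"
    and z: "summable (\<lambda>n. norm (z n) powr p)"
  shows "summable (\<lambda>n. norm (f (z n) - f 0) powr q)"
proof -
  define x where "x n = (if even n then 0 else z ((n - 1) div 2))" for n
  have "summable (\<lambda>n. if even n then 0 else norm (z ((n - 1) div 2)) powr p)"
    using sums_if'[OF summable_sums[OF z]] by (rule sums_summable)
  also have "(\<lambda>n. if even n then 0 else norm (z ((n - 1) div 2)) powr p) = (\<lambda>n. norm (x n) powr p)"
    by (auto simp: x_def)
  finally have "summable (\<lambda>n. norm (f (x (Suc n)) - f (x n)) powr q)"
    using maps by (auto simp: lp_space_def bv_space_def comp_op_def)
  then have "summable ((\<lambda>n. norm (f (x (Suc n)) - f (x n)) powr q) \<circ> (\<lambda>n. 2 * n))"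
    by (rule summable_reindex) (auto simp: inj_on_def)
  then show ?thesis by (simp add: x_def o_def)
qed

section \<open>Comparison of the variation distance with the \<open>q\<close>-norm\<close>

lemma norm_powr_le_lp_norm_powr:
  assumes "1 \<le> p" "x \<in> lp_space p"
  shows "norm (x n) powr p \<le> lp_norm p x powr p"
proof -
  have "norm (x n) powr p \<le> (\<Sum>n. norm (x n) powr p)"
    using sum_le_suminf[of "\<lambda>n. norm (x n) powr p" "{n}"] assms by (simp add: lp_space_def)
  also have "\<dots> \<le> lp_norm p x powr p"
    using assms by (intro lp_suminf_le) auto
  finally show ?thesis .
qed

text \<open>The increments of \<open>x - y\<close> are its shift minus itself, which gives two
  copies of the norm; the initial term gives the third. Only the difference has to lie in
  \<open>lp_space q\<close>: images under \<open>comp_op f\<close> need not, as they may tend to a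
  nonzero \<open>f 0\<close>.\<close>

lemma bv_dist_le_lp_norm:
  fixes x y :: "nat \<Rightarrow> 'a::real_normed_vector"
  assumes q: "1 \<le> q" and xy: "(\<lambda>n. x n - y n) \<in> lp_space q"
  shows "bv_dist q x y \<le> 3 * lp_norm q (\<lambda>n. x n - y n)"
proof -
  have minkowski_diff: "lp_norm q (\<lambda>n. a n - b n) \<le> lp_norm q a + lp_norm q b"
    if "a \<in> lp_space q" "b \<in> lp_space q" for a b :: "nat \<Rightarrow> 'a"
    using lp_minkowski(2)[OF q that(1), of "\<lambda>n. - b n"] that(2)
    by (simp add: lp_space_def lp_norm_def)
  let ?w = "\<lambda>n. x n - y n" and ?s = "\<lambda>n. x (Suc n) - y (Suc n)"
  have sw: "summable (\<lambda>n. norm (?w n) powr q)"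
    using xy by (simp add: lp_space_def)
  then have s: "?s \<in> lp_space q"
    unfolding lp_space_def using summable_Suc_iff[of "\<lambda>n. norm (?w n) powr q"] by simp
  have "(\<Sum>n. norm (?s n) powr q) \<le> (\<Sum>n. norm (?w n) powr q)"
    using suminf_split_head[OF sw] by simp
  then have "lp_norm q ?s \<le> lp_norm q ?w"
    unfolding lp_norm_def using q s by (intro powr_mono2 suminf_nonneg) (auto simp: lp_space_def)
  moreover have "lp_norm q (\<lambda>n. ?s n - ?w n) \<le> lp_norm q ?s + lp_norm q ?w"
    using minkowski_diff[OF s xy] .
  moreover have "(\<lambda>n. (x (Suc n) - x n) - (y (Suc n) - y n)) = (\<lambda>n. ?s n - ?w n)"
    by (simp add: algebra_simps)
  moreover have "norm (?w 0) \<le> lp_norm q ?w"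
  proof -
    have "(norm (?w 0) powr q) powr (1 / q) \<le> (lp_norm q ?w powr q) powr (1 / q)"
      using q norm_powr_le_lp_norm_powr[OF q xy, of 0] by (intro powr_mono2[of "1 / q"]) auto
    then show ?thesis using q lp_norm_nonneg[of q ?w] by (simp add: powr_powr)
  qed
  ultimately show ?thesis by (simp add: bv_dist_eq_lp)
qed

section \<open>Sufficiency of the continuity of \<open>f\<close>\<close>

lemma ball_lessThan_continuous_near:
  fixes f :: "'a::real_normed_vector \<Rightarrow> 'b::real_normed_vector" and N :: nat
  assumes f: "continuous_on UNIV f" and "0 < q" "0 < \<epsilon>"
  shows "\<forall>\<^sub>F r in at_right 0. \<forall>n<N. \<forall>v. norm (x n - v) < r \<longrightarrow> norm (f (x n) - f v) powr q < \<epsilon>"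
proof -
  have "\<forall>\<^sub>F r in at_right 0. \<forall>v. norm (u - v) < r \<longrightarrow> norm (f u - f v) powr q < \<epsilon>" for u
  proof -
    have "0 < \<epsilon> powr (1 / q)" using assms by simp
    moreover have "isCont f u"
      using f by (simp add: continuous_on_eq_continuous_at)
    ultimately obtain d where d: "d > 0" "\<And>v. dist v u < d \<Longrightarrow> dist (f v) (f u) < \<epsilon> powr (1 / q)"
      unfolding continuous_at_eps_delta by metis
    have "norm (f u - f v) powr q < \<epsilon>" if "norm (u - v) < d" for v
    proof -
      have "norm (f u - f v) < \<epsilon> powr (1 / q)"
        using d(2)[of v] that by (simp add: dist_norm norm_minus_commute)
      then have "norm (f u - f v) powr q < (\<epsilon> powr (1 / q)) powr q"
        using assms by (intro powr_less_mono2) auto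
      then show ?thesis using assms by (simp add: powr_powr)
    qed
    then show ?thesis
      unfolding eventually_at_right_field using d(1) by (intro exI[of _ d]) auto
  qed
  then have "\<forall>\<^sub>F r in at_right 0. \<forall>n\<in>{..<N}. \<forall>v. norm (x n - v) < r \<longrightarrow> norm (f (x n) - f v) powr q < \<epsilon>"
    by (intro eventually_ball_finite) auto
  then show ?thesis by (simp add: Ball_def)
qed

text \<open>Continuity at the finitely many points \<open>x n\<close> with \<open>n < N\<close>
  controls the head of the sum, and the growth bound at \<open>0\<close> controls the tail uniformly
  in \<open>y\<close>. With \<open>\<eta> = \<epsilon> powr q\<close>, the head, the tail of
  \<open>x\<close> and the tail of \<open>x - y\<close> each contribute at most
  \<open>\<eta> / 3\<close>.\<close>

lemma lp_norm_comp_diff_small: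
  fixes f :: "'a::real_normed_vector \<Rightarrow> 'a"
  assumes p: "1 \<le> p" and q: "1 \<le> q" and f: "continuous_on UNIV f"
    and L: "0 < \<delta>" "0 < L"
      "\<And>u. norm u powr p \<le> \<delta> \<Longrightarrow> norm (f u - f 0) powr q \<le> L * norm u powr p"
    and x: "x \<in> lp_space p" and "0 < \<epsilon>"
  obtains d where "0 < d" "\<And>y. y \<in> lp_space p \<Longrightarrow> lp_dist p x y < d \<Longrightarrow>
      (\<lambda>n. f (x n) - f (y n)) \<in> lp_space q \<and> lp_norm q (\<lambda>n. f (x n) - f (y n)) < \<epsilon>"
proof -
  define \<eta> where "\<eta> = \<epsilon> powr q"
  have "0 < \<eta>" using \<open>0 < \<epsilon>\<close> by (simp add: \<eta>_def)
  \<comment> \<open>\<open>c\<close> is the cost of splitting a \<open>p\<close>-th power.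
    \<open>C\<close> collects the cost \<open>2 powr q\<close> of splitting at \<open>f 0\<close>,
    the growth constant \<open>L\<close>, and \<open>c\<close> once for \<open>x\<close> and once
    for \<open>y\<close>.\<close>
  define c where "c = (2::real) powr p"
  define C where "C = 2 powr q * (L * (2 * c))"
  have c: "1 \<le> c" using p by (simp add: c_def ge_one_powr_ge_zero)
  have C: "0 < C" using L c by (simp add: C_def)
  have sx: "summable (\<lambda>n. norm (x n) powr p)" using x by (simp add: lp_space_def)
  \<comment> \<open>The first bound makes a tail worth \<open>\<eta> / 3\<close> after
    multiplication by \<open>C\<close>; the second keeps the tail terms of both \<open>x\<close> and
    \<open>y\<close> within the range \<open>\<delta>\<close> of the growth bound.\<close>
  have "0 < min (\<eta> / (3 * C)) (\<delta> / (2 * c))" using \<open>0 < \<eta>\<close> C L c by simp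
  from suminf_exist_split[OF this sx] obtain N where
    N: "norm (\<Sum>i. norm (x (i + N)) powr p) < min (\<eta> / (3 * C)) (\<delta> / (2 * c))"
    by blast
  have sxN: "summable (\<lambda>i. norm (x (i + N)) powr p)"
    using sx summable_iff_shift[of "\<lambda>n. norm (x n) powr p" N] by simp
  have tail: "(\<Sum>i. norm (x (i + N)) powr p) < \<eta> / (3 * C)"
    using N by (simp add: abs_less_iff)
  have x_le: "norm (x (i + N)) powr p \<le> \<delta> / (2 * c)" for i
    using sum_le_suminf[OF sxN, of "{i}"] N by (simp add: abs_less_iff)
  have lim: "((\<lambda>r. r powr p) \<longlongrightarrow> 0) (at_right (0::real))"
    using p eventually_at_right_less[of "0::real"]
    by (intro tendsto_zero_powrI[of _ _ _ p] tendsto_ident_at tendsto_const)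
      (auto elim: eventually_mono)
  have "\<forall>\<^sub>F r in at_right 0. r powr p < \<eta> / (3 * C)" "\<forall>\<^sub>F r in at_right 0. r powr p < \<delta> / (2 * c)"
    using \<open>0 < \<eta>\<close> C L c by (auto intro!: order_tendstoD[OF lim])
  \<comment> \<open>The summand \<open>1\<close> in the denominator keeps the threshold positive
    when \<open>N = 0\<close>.\<close>
  moreover have "\<forall>\<^sub>F r in at_right 0. \<forall>n<N. \<forall>v. norm (x n - v) < r \<longrightarrow>
      norm (f (x n) - f v) powr q < \<eta> / (3 * (real N + 1))"
    using q \<open>0 < \<eta>\<close> by (intro ball_lessThan_continuous_near[OF f]) auto
  moreover have "\<forall>\<^sub>F r in at_right 0. 0 < (r::real)"
    by (rule eventually_at_right_less)
  ultimately have "\<forall>\<^sub>F r in at_right 0. 0 < r \<and> r powr p < \<eta> / (3 * C) \<and> r powr p < \<delta> / (2 * c) \<and>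
      (\<forall>n<N. \<forall>v. norm (x n - v) < r \<longrightarrow> norm (f (x n) - f v) powr q < \<eta> / (3 * (real N + 1)))"
    by eventually_elim simp
  then obtain d where d: "0 < d" "d powr p < \<eta> / (3 * C)" "d powr p < \<delta> / (2 * c)"
    and head: "\<And>n v. n < N \<Longrightarrow> norm (x n - v) < d \<Longrightarrow>
      norm (f (x n) - f v) powr q < \<eta> / (3 * (real N + 1))"
    using eventually_happens'[OF trivial_limit_at_right_real[of "0::real"]] by blast
  show thesis
  proof (rule that[OF d(1)])
    fix y assume y: "y \<in> lp_space p" and dist: "lp_dist p x y < d"
    define w where "w n = x n - y n" for n
    have w: "w \<in> lp_space p" using lp_space_diff[OF p x y] by (simp add: w_def[abs_def])
    have w_norm: "lp_norm p w < d" using dist by (simp add: w_def[abs_def] lp_dist_def)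
    have sw: "summable (\<lambda>n. norm (w n) powr p)" using w by (simp add: lp_space_def)
    then have swN: "summable (\<lambda>i. norm (w (i + N)) powr p)"
      using summable_iff_shift[of "\<lambda>n. norm (w n) powr p" N] by simp
    have w_sum: "(\<Sum>n. norm (w n) powr p) \<le> d powr p"
      using lp_suminf_le[OF p w] w_norm by simp
    have w_powr: "norm (w n) powr p \<le> d powr p" for n
      using sum_le_suminf[OF sw, of "{n}"] w_sum by simp
    have w_lt: "norm (w n) < d" for n
    proof (rule ccontr)
      assume "\<not> norm (w n) < d"
      then have "d \<le> norm (w n)" by simp
      moreover have "norm (w n) powr p \<le> lp_norm p w powr p"
        by (rule norm_powr_le_lp_norm_powr[OF p w])
      moreover have "lp_norm p w powr p < d powr p"
        using w_norm p lp_norm_nonneg[of p w] by (intro powr_less_mono2) auto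
      ultimately show False
        using powr_mono2[of p d "norm (w n)"] p d(1) by simp
    qed
    define h where "h n = norm (f (x n) - f (y n)) powr q" for n
    have h_tail: "h (i + N) \<le> C * (norm (x (i + N)) powr p + norm (w (i + N)) powr p)" for i
    proof -
      let ?X = "norm (x (i + N)) powr p" and ?W = "norm (w (i + N)) powr p"
        and ?Y = "norm (y (i + N)) powr p"
      have Y: "?Y \<le> c * (?X + ?W)"
        using norm_diff_powr_le[of p "x (i + N)" "w (i + N)"] p by (simp add: w_def c_def)
      \<comment> \<open>The same bound as for \<open>y\<close>, so that one check against
        \<open>\<delta>\<close> serves both points.\<close>
      have X: "?X \<le> c * (?X + ?W)"
        using mult_mono[of 1 c ?X "?X + ?W"] c by simp
      have "c * (?X + ?W) \<le> c * (\<delta> / (2 * c) + \<delta> / (2 * c))"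
        using c x_le[of i] w_powr[of "i + N"] d by (intro mult_left_mono add_mono) auto
      also have "\<dots> = \<delta>" using c by simp
      finally have \<delta>: "c * (?X + ?W) \<le> \<delta>" .
      have "h (i + N) \<le> 2 powr q * (norm (f (x (i + N)) - f 0) powr q + norm (f (y (i + N)) - f 0) powr q)"
        using norm_diff_powr_le[of q "f (x (i + N)) - f 0" "f (y (i + N)) - f 0"] q
        by (simp add: h_def)
      also have "\<dots> \<le> 2 powr q * (L * ?X + L * ?Y)"
        using X Y \<delta> by (intro mult_left_mono add_mono L(3)) auto
      also have "\<dots> \<le> 2 powr q * (L * (c * (?X + ?W)) + L * (c * (?X + ?W)))"
        using X Y L by (intro mult_left_mono add_mono) auto
      also have "\<dots> = C * (?X + ?W)" by (simp add: C_def algebra_simps)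
      finally show ?thesis .
    qed
    have sg: "summable (\<lambda>i. C * (norm (x (i + N)) powr p + norm (w (i + N)) powr p))"
      by (intro summable_mult summable_add sxN swN)
    have shN: "summable (\<lambda>i. h (i + N))"
      by (rule summable_comparison_test'[OF sg, of 0]) (use h_tail in \<open>auto simp: h_def\<close>)
    then have sh: "summable h" by (simp add: summable_iff_shift)
    have "(\<Sum>i. norm (w (i + N)) powr p) \<le> (\<Sum>n. norm (w n) powr p)"
      using suminf_split_initial_segment[OF sw, of N] sum_nonneg[of "{..<N}" "\<lambda>n. norm (w n) powr p"]
      by simp
    then have wN: "(\<Sum>i. norm (w (i + N)) powr p) < \<eta> / (3 * C)"
      using w_sum d by linarith
    have "(\<Sum>i. h (i + N)) \<le> (\<Sum>i. C * (norm (x (i + N)) powr p + norm (w (i + N)) powr p))"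
      by (rule suminf_le[OF h_tail shN sg])
    also have "\<dots> = C * ((\<Sum>i. norm (x (i + N)) powr p) + (\<Sum>i. norm (w (i + N)) powr p))"
      using sxN swN by (simp add: suminf_mult suminf_add summable_add)
    also have "\<dots> < C * (\<eta> / (3 * C) + \<eta> / (3 * C))"
      using tail wN C by (intro mult_strict_left_mono add_strict_mono) auto
    also have "\<dots> = 2 * \<eta> / 3" using C by simp
    finally have h_tail_sum: "(\<Sum>i. h (i + N)) < 2 * \<eta> / 3" .
    have "(\<Sum>n<N. h n) \<le> (\<Sum>n<N. \<eta> / (3 * (real N + 1)))"
      unfolding h_def using w_lt by (intro sum_mono less_imp_le head) (auto simp: w_def)
    also have "\<dots> \<le> \<eta> / 3"
      using \<open>0 < \<eta>\<close> by (simp add: field_simps)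
    finally have "suminf h < \<eta>"
      using suminf_split_initial_segment[OF sh, of N] h_tail_sum by simp
    then have "suminf h powr (1 / q) < \<eta> powr (1 / q)"
      using q sh by (intro powr_less_mono2 suminf_nonneg) (auto simp: h_def)
    also have "\<dots> = \<epsilon>" using q \<open>0 < \<epsilon>\<close> by (simp add: \<eta>_def powr_powr)
    finally show "(\<lambda>n. f (x n) - f (y n)) \<in> lp_space q \<and> lp_norm q (\<lambda>n. f (x n) - f (y n)) < \<epsilon>"
      using sh by (simp add: lp_space_def lp_norm_def h_def[abs_def])
  qed
qed

section \<open>Necessity of the continuity of \<open>f\<close>, and the equivalence\<close>

definition single_seq :: "'a::zero \<Rightarrow> nat \<Rightarrow> 'a" where
  "single_seq u n = (if n = 0 then u else 0)"

lemma single_seq_in_lp_space: "single_seq u \<in> lp_space p"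
  unfolding lp_space_def mem_Collect_eq
  by (rule summable_finite[of "{0}"]) (auto simp: single_seq_def)

lemma lp_dist_single_seq:
  assumes "1 \<le> p"
  shows "lp_dist p (single_seq u) (single_seq v) = norm (u - v)"
proof -
  have "(\<Sum>n. norm (single_seq u n - single_seq v n) powr p) = norm (u - v) powr p"
    by (subst suminf_finite[of "{0}"]) (auto simp: single_seq_def)
  then show ?thesis
    using assms by (simp add: lp_dist_def lp_norm_def powr_powr)
qed

theorem theorem10:
  fixes f :: "'a::real_normed_vector \<Rightarrow> 'a" and p q :: real
  assumes "1 \<le> p" and "1 \<le> q"
    and "\<forall>x \<in> lp_space p. comp_op f x \<in> bv_space q"
  shows "continuous_map (lp_topology p) (bv_topology q) (comp_op f) \<longleftrightarrow> continuous_on UNIV f"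
proof -
  have cont_iff: "continuous_map (lp_topology p) (bv_topology q) (comp_op f) \<longleftrightarrow>
      (\<forall>x \<in> lp_space p. \<forall>\<epsilon>>0. \<exists>d>0. \<forall>y. y \<in> lp_space p \<and> lp_dist p x y < d \<longrightarrow>
        bv_dist q (comp_op f x) (comp_op f y) < \<epsilon>)"
    unfolding lp_topology_def bv_topology_def
    using Metric_space.metric_continuous_map[OF Metric_space_lp[OF assms(1)] Metric_space_bv[OF assms(2)],
        of "comp_op f"] assms(3)
    by (simp add: image_subset_iff)
  show ?thesis
  proof
    assume cont: "continuous_map (lp_topology p) (bv_topology q) (comp_op f)"
    have "\<exists>d>0. \<forall>v. dist v u < d \<longrightarrow> dist (f v) (f u) < \<epsilon>" if "0 < \<epsilon>" for u \<epsilon>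
    proof -
      obtain d where d: "0 < d" "\<And>y. y \<in> lp_space p \<Longrightarrow> lp_dist p (single_seq u) y < d \<Longrightarrow>
          bv_dist q (comp_op f (single_seq u)) (comp_op f y) < \<epsilon>"
        using cont \<open>0 < \<epsilon>\<close> single_seq_in_lp_space[of u p] unfolding cont_iff by metis
      have "dist (f v) (f u) < \<epsilon>" if "dist v u < d" for v
      proof -
        \<comment> \<open>The variation norm contains the norm of the initial term, where the two
          images are \<open>f u\<close> and \<open>f v\<close>. Since \<open>single_seq\<close> is
          isometric, continuity of \<open>comp_op f\<close> at \<open>single_seq u\<close> passes to
          \<open>f\<close> at \<open>u\<close>.\<close>
        have "norm (f u - f v) \<le> bv_dist q (comp_op f (single_seq u)) (comp_op f (single_seq v))"
          by (simp add: bv_dist_eq_lp lp_norm_nonneg comp_op_def single_seq_def)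
        also have "\<dots> < \<epsilon>"
          using that by (intro d(2) single_seq_in_lp_space)
            (simp add: lp_dist_single_seq[OF assms(1)] dist_norm norm_minus_commute)
        finally show ?thesis by (simp add: dist_norm norm_minus_commute)
      qed
      then show ?thesis using d(1) by blast
    qed
    then show "continuous_on UNIV f"
      by (simp add: continuous_on_iff)
  next
    assume f: "continuous_on UNIV f"
    obtain \<delta> L where L: "0 < \<delta>" "0 < L"
      "\<And>u. norm u powr p \<le> \<delta> \<Longrightarrow> norm (f u - f 0) powr q \<le> L * norm u powr p"
      using local_bound_of_summable_comp[of "\<lambda>u. norm u powr p" "\<lambda>u. norm (f u - f 0) powr q" 0,
          OF _ _ _ _ summable_comp_diff_zero[OF assms(1,3)]]
      by auto
    show "continuous_map (lp_topology p) (bv_topology q) (comp_op f)"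
      unfolding cont_iff
    proof (intro ballI allI impI)
      fix x :: "nat \<Rightarrow> 'a" and \<epsilon> :: real
      assume x: "x \<in> lp_space p" and "0 < \<epsilon>"
      \<comment> \<open>The tolerance \<open>\<epsilon> / 3\<close> absorbs the factor
        \<open>3\<close> in \<open>bv_dist_le_lp_norm\<close>.\<close>
      then obtain d where d: "0 < d" "\<And>y. y \<in> lp_space p \<Longrightarrow> lp_dist p x y < d \<Longrightarrow>
          (\<lambda>n. f (x n) - f (y n)) \<in> lp_space q \<and> lp_norm q (\<lambda>n. f (x n) - f (y n)) < \<epsilon> / 3"
        using lp_norm_comp_diff_small[OF assms(1,2) f L x, of "\<epsilon> / 3"] by auto
      have "bv_dist q (comp_op f x) (comp_op f y) < \<epsilon>" if "y \<in> lp_space p" "lp_dist p x y < d" for y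
        using d(2)[OF that] bv_dist_le_lp_norm[OF assms(2), of "comp_op f x" "comp_op f y"]
        by (simp add: comp_op_def)
      then show "\<exists>d>0. \<forall>y. y \<in> lp_space p \<and> lp_dist p x y < d \<longrightarrow>
          bv_dist q (comp_op f x) (comp_op f y) < \<epsilon>"
        using d(1) by blast
    qed
  qed
qed

end
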